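(* Consider formal power series solutions $f(t,\psi)=\sum_{\lambda\ge 0} f_\lambda(\tau,\psi)\epsilon^\lambda$, with $\tau=\Omega t$, $\Omega^2=\sum_{\lambda\ge0}\theta_\lambda\epsilon^\lambda$, $\theta_0=1$, $f_0=0$, $f_1(\tau,\psi)=\cos(\tau)e_0(\psi)$, of the boundary value problem $$-\partial_t^2 f+\partial_\psi^2 f=\frac{f^3}{\sin^2\psi}\quad (t\in\mathbb{R},\ 0<\psi<\pi),\qquad f(t,0)=f(t,\pi)=0,$$ with zero initial velocity $\partial_t f(0,\cdot)=0$. Write $f_\lambda(\tau,\psi)=\sum_{i\ge0}f_\lambda^{(i)}(\tau)e_i(\psi)$, so that the coefficients $f_\lambda^{(m)}$ satisfy the resonant system described in the context with $\dot f_\lambda^{(m)}(0)=0$ for all $\lambda,m\ge0$. Then the resonant system admits no secular term, for a suitable choice of the frequency shifts $\theta_1,\theta_2,\dots\in\mathbb{R}$, if and only if the initial data are all proportional to $e_0$, that is, $f_\lambda^{(m)}(0)=0$ for all $\lambda\ge 0$ and all $m\ge1$ (equivalently $f_\lambda(0,\cdot)=f_\lambda^{(0)}(0)\,e_0$ for every $\lambda$).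
   Context: Notation: $\omega_i=i+1$ and $e_i(\psi)=\sin(\omega_i\psi)$, $i=0,1,2,\dots$; these are the Dirichlet eigenfunctions of $-\partial_\psi^2$ on $[0,\pi]$, and $(g|h)=\frac{2}{\pi}\int_0^\pi g h\,d\psi$. The interaction coefficients are $$C_{ijk}^{(m)}=\frac{2}{\pi}\int_0^\pi\frac{e_i(\psi)e_j(\psi)e_k(\psi)e_m(\psi)}{\sin^2(\psi)}\,d\psi .$$ Dots denote $d/d\tau$. Resonant system (obtained by substituting the formal series in the equation, collecting powers of $\epsilon$ and projecting on $e_m$): $f_0^{(m)}=0$ and $f_1^{(m)}(\tau)=\delta_{0}^{m}\cos(\tau)$ for all $m\ge 0$ ($\delta_0^m$ the Kronecker delta), and for all $\lambda\ge2$, $m\ge0$, $$\ddot f_\lambda^{(m)}(\tau)+\omega_m^2 f_\lambda^{(m)}(\tau)=S_\lambda^{(m)}(\tau),$$ $$S_\lambda^{(m)}=-\sum_{i,j,k=0}^\infty C_{ijk}^{(m)}\sum_{\substack{\mu,\nu,\rho\ge1\\ \mu+\nu+\rho=\lambda}}f_\mu^{(i)}f_\nu^{(j)}f_\rho^{(k)}-\sum_{\substack{\mu\ge0,\ \nu\ge1\\ \mu+\nu=\lambda}}\theta_\nu\,\ddot f_\mu^{(m)} .$$ The initial values $f_\lambda^{(m)}(0)\in\mathbb{R}$ for $\lambda\ge2$, $m\ge0$ are the data; the series in the system are assumed to make sense. Secular terms are the terms of the form $\tau\sin(\omega_m\tau)$ or $\tau\cos(\omega_m\tau)$ in $f_\lambda^{(m)}(\tau)$,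 which destroy periodicity; they arise when $\cos(\omega_m\tau)$ or $\sin(\omega_m\tau)$ occurs in the Fourier expansion of the source $S_\lambda^{(m)}$. "The resonant system admits no secular term" means that no such term occurs for any $\lambda\ge2$, $m\ge0$, i.e. every $f_\lambda^{(m)}$ is $2\pi$-periodic in $\tau$. *)

theory Defs
  imports "HOL-Analysis.Analysis"
begin

definition eig_freq :: "nat \<Rightarrow> real" where
  "eig_freq i = real i + 1"

definition eig :: "nat \<Rightarrow> real \<Rightarrow> real" where
  "eig i \<psi> = sin (eig_freq i * \<psi>)"

definition inner_prod :: "(real \<Rightarrow> real) \<Rightarrow> (real \<Rightarrow> real) \<Rightarrow> real" where
  "inner_prod g h = 2 / pi * integral {0..pi} (\<lambda>\<psi>. g \<psi> * h \<psi>)"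

(* At the two endpoints the integrand is 0 by the convention x / 0 = 0; this does not
   affect the integral. *)
definition interaction_coeff :: "nat \<Rightarrow> nat \<Rightarrow> nat \<Rightarrow> nat \<Rightarrow> real" where
  "interaction_coeff i j k m =
     2 / pi * integral {0..pi} (\<lambda>\<psi>. eig i \<psi> * eig j \<psi> * eig k \<psi> * eig m \<psi> / (sin \<psi>)\<^sup>2)"

(* In what follows f n m is the coefficient of epsilon^n e_m in the formal solution, a function
   of the rescaled time tau = Omega t, where Omega^2 is the formal series with coefficients
   \<theta> n; the equation is - f_tt + f_psipsi = f^3 / sin^2 psi with Dirichlet conditions. *)

definition cubic_term ::
  "(nat \<Rightarrow> nat \<Rightarrow> real \<Rightarrow> real) \<Rightarrow> nat \<Rightarrow> nat \<Rightarrow> real \<Rightarrow> nat \<times> nat \<times> nat \<Rightarrow> real" where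
  "cubic_term f n m \<tau> = (\<lambda>(i, j, k).
     interaction_coeff i j k m *
       (\<Sum>(\<mu>, \<nu>, \<rho>) \<in> {(\<mu>, \<nu>, \<rho>). 1 \<le> \<mu> \<and> 1 \<le> \<nu> \<and> 1 \<le> \<rho> \<and> \<mu> + \<nu> + \<rho> = n}.
          f \<mu> i \<tau> * f \<nu> j \<tau> * f \<rho> k \<tau>))"

definition source ::
  "(nat \<Rightarrow> real) \<Rightarrow> (nat \<Rightarrow> nat \<Rightarrow> real \<Rightarrow> real) \<Rightarrow> nat \<Rightarrow> nat \<Rightarrow> real \<Rightarrow> real" where
  "source \<theta> f n m \<tau> =
     - (\<Sum>\<^sub>\<infinity> ijk \<in> UNIV. cubic_term f n m \<tau> ijk)
     - (\<Sum>(\<mu>, \<nu>) \<in> {(\<mu>, \<nu>). 1 \<le> \<nu> \<and> \<mu> + \<nu> = n}. \<theta> \<nu> * deriv (deriv (f \<mu> m)) \<tau>)"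

(* a n m is the prescribed initial value of f n m. The summability clause says that the series
   in the source make sense; without it infsum would silently be 0. *)
definition resonant_solution ::
  "(nat \<Rightarrow> real) \<Rightarrow> (nat \<Rightarrow> nat \<Rightarrow> real) \<Rightarrow> (nat \<Rightarrow> nat \<Rightarrow> real \<Rightarrow> real) \<Rightarrow> bool" where
  "resonant_solution \<theta> a f \<longleftrightarrow>
     (\<forall>m \<tau>. f 0 m \<tau> = 0) \<and>
     (\<forall>m \<tau>. f 1 m \<tau> = (if m = 0 then cos \<tau> else 0)) \<and>
     (\<forall>n m. f n m differentiable_on UNIV \<and> deriv (f n m) differentiable_on UNIV) \<and>
     (\<forall>n\<ge>2. \<forall>m \<tau>. cubic_term f n m \<tau> summable_on UNIV \<and>
        deriv (deriv (f n m)) \<tau> + (eig_freq m)\<^sup>2 * f n m \<tau> = source \<theta> f n m \<tau>) \<and>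
     (\<forall>n m. f n m 0 = a n m) \<and>
     (\<forall>n m. deriv (f n m) 0 = 0)"

(* A secular term tau * sin (omega_m tau) or tau * cos (omega_m tau) is one that
   destroys 2 pi-periodicity; its absence means periodicity of all coefficients. *)
definition no_secular_term :: "(nat \<Rightarrow> nat \<Rightarrow> real \<Rightarrow> real) \<Rightarrow> bool" where
  "no_secular_term f \<longleftrightarrow> (\<forall>n\<ge>2. \<forall>m \<tau>. f n m (\<tau> + 2 * pi) = f n m \<tau>)"

(* g is the sum of the series of c i * eig i, in the norm induced by inner_prod *)
definition has_eig_expansion :: "(real \<Rightarrow> real) \<Rightarrow> (nat \<Rightarrow> real) \<Rightarrow> bool" where
  "has_eig_expansion g c \<longleftrightarrow>
     (\<lambda>N. let r = (\<lambda>\<psi>. g \<psi> - (\<Sum>i<N. c i * eig i \<psi>)) in inner_prod r r) \<longlonglongrightarrow> 0"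

end

theory Submission
  imports Defs
begin

text \<open>Because \<open>e\<^sub>0 = sin\<close> cancels against the weight, \<open>C\<^bsub>i00\<^esub>\<^sup>m\<close> is the Kronecker delta.

  If the modes \<open>m \<ge> 1\<close> vanish below order \<open>N\<close>, then \<open>f\<^sub>N\<^sup>m = A cos (\<omega> \<tau>)\<close> with \<open>\<omega> = m + 1\<close>, and the
  delta identity makes the source at order \<open>N + 2\<close> equal to
  \<open>- 3 cos\<^sup>2 \<tau> f\<^sub>N\<^sup>m + \<theta>\<^sub>2 \<omega>\<^sup>2 f\<^sub>N\<^sup>m\<close>. The ground mode at orders 2 and 3 forces \<open>\<theta>\<^sub>1 = 0\<close> and
  \<open>\<theta>\<^sub>2 = 3/4\<close>, so the resonant Fourier coefficient is \<open>(3/4) A (\<omega>\<^sup>2 - 2)\<close>. As \<open>\<omega>\<close> is an integer, its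
  vanishing gives \<open>A = 0\<close>.

  Conversely, on the ground mode alone the system is the Duffing equation \<open>x'' + x = - x\<^sup>3\<close>, whose
  Poincare--Lindstedt expansion consists of even trigonometric polynomials for any initial values.\<close>

section \<open>Orthogonality of the modes and the interaction coefficients\<close>

text \<open>The factor \<open>N\<close> lets the same integral serve space, over [0, pi], and time,
  over [0, 2 pi].\<close>

lemma has_integral_cos_int:
  fixes k :: int and N :: nat
  shows "((\<lambda>x. cos (of_int k * x)) has_integral (if k = 0 then real N * pi else 0)) {0..real N * pi}"
proof (cases "k = 0")
  case True
  show ?thesis using has_integral_const_real[of "1::real" 0 "real N * pi"] True by simp
next
  case False
  have "((\<lambda>x. cos (of_int k * x)) has_integral
      (sin (of_int k * (real N * pi)) / of_int k - sin (of_int k * 0) / of_int k)) {0..real N * pi}"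
    by (rule fundamental_theorem_of_calculus)
      (use False in \<open>auto intro!: derivative_eq_intros
         simp: has_real_derivative_iff_has_vector_derivative[symmetric]\<close>)
  moreover have "sin (of_int k * (real N * pi)) = 0"
    using sin_times_pi_eq_0[of "of_int k * real N"] by (simp add: mult.assoc)
  ultimately show ?thesis using False by simp
qed

text \<open>Positivity of \<open>p\<close> keeps the cases \<open>q = p\<close> and
  \<open>q = - p\<close> apart; \<open>q\<close> may have any sign, which admits the frequency
  \<open>p - 2\<close> later.\<close>

lemma has_integral_cos_cos:
  fixes p q :: int
  assumes "p > 0"
  shows "((\<lambda>x. cos (of_int q * x) * cos (of_int p * x)) has_integral
           (if q = p \<or> q = - p then pi else 0)) {0..2 * pi}"
proof -
  have "((\<lambda>x. 1 / 2 * (cos (of_int (q - p) * x) + cos (of_int (q + p) * x))) has_integral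
      1 / 2 * ((if q - p = 0 then real 2 * pi else 0) + (if q + p = 0 then real 2 * pi else 0)))
      {0..real 2 * pi}"
    by (intro has_integral_mult_right has_integral_add has_integral_cos_int)
  moreover have "1 / 2 * (cos (of_int (q - p) * x) + cos (of_int (q + p) * x))
      = cos (of_int q * x) * cos (of_int p * x)" for x :: real
    by (simp add: cos_add cos_diff algebra_simps)
  moreover have "1 / 2 * ((if q - p = 0 then real 2 * pi else 0) + (if q + p = 0 then real 2 * pi else 0))
      = (if q = p \<or> q = - p then pi else 0)"
    using assms by auto
  ultimately show ?thesis by simp
qed

lemma inner_prod_eig:
  "inner_prod (eig i) (eig m) = (if i = m then 1 else 0)"
proof -
  have "((\<lambda>x. 1 / 2 * (cos (of_int (int i - int m) * x) - cos (of_int (int i + int m + 2) * x)))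
      has_integral 1 / 2 * ((if int i - int m = 0 then real 1 * pi else 0) -
        (if int i + int m + 2 = 0 then real 1 * pi else 0))) {0..real 1 * pi}"
    by (intro has_integral_mult_right has_integral_diff has_integral_cos_int)
  moreover have "1 / 2 * (cos (of_int (int i - int m) * x) - cos (of_int (int i + int m + 2) * x))
      = eig i x * eig m x" for x :: real
    by (simp add: sin_times_sin eig_def eig_freq_def algebra_simps)
  ultimately have "((\<lambda>x. eig i x * eig m x) has_integral (if i = m then pi / 2 else 0)) {0..pi}"
    by (auto split: if_splits)
  then show ?thesis by (auto simp: inner_prod_def integral_unique)
qed

lemma continuous_on_eig [continuous_intros]: "continuous_on A (eig i)"
  unfolding eig_def by (intro continuous_intros)

lemma interaction_coeff_0_0:
  "interaction_coeff i 0 0 m = (if i = m then 1 else 0)"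
  "interaction_coeff 0 i 0 m = (if i = m then 1 else 0)"
  "interaction_coeff 0 0 i m = (if i = m then 1 else 0)"
proof -
  have eq: "eig i x * eig 0 x * eig 0 x * eig m x / (sin x)\<^sup>2 = eig i x * eig m x"
    if "x \<in> {0..pi}" for x
  proof (cases "sin x = 0")
    case True
    \<comment> \<open>At the endpoints the quotient is 0 because \<open>x / 0 = 0\<close>, and the
      right-hand side is 0 by the Dirichlet condition, so the identity holds on the whole closed
      interval.\<close>
    with that have "x = 0 \<or> x = pi" using sin_gt_zero[of x] by force
    then have "eig i x = 0"
      using sin_npi[of "Suc i"] by (auto simp: eig_def eig_freq_def add.commute)
    then show ?thesis by simp
  next
    case False
    then show ?thesis by (simp add: eig_def[of 0] eig_freq_def power2_eq_square)
  qed
  have "integral {0..pi} (\<lambda>x. eig i x * eig 0 x * eig 0 x * eig m x / (sin x)\<^sup>2)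
      = integral {0..pi} (\<lambda>x. eig i x * eig m x)"
    by (rule integral_cong) (rule eq)
  then show *: "interaction_coeff i 0 0 m = (if i = m then 1 else 0)"
    using inner_prod_eig[of i m] unfolding interaction_coeff_def inner_prod_def by simp
  then show "interaction_coeff 0 i 0 m = (if i = m then 1 else 0)"
      "interaction_coeff 0 0 i m = (if i = m then 1 else 0)"
    unfolding interaction_coeff_def by (simp_all add: mult_ac)
qed

lemma inner_prod_sum_eig:
  assumes "finite I"
  shows "inner_prod (\<lambda>\<psi>. \<Sum>i\<in>I. c i * eig i \<psi>) (\<lambda>\<psi>. \<Sum>i\<in>I. c i * eig i \<psi>) = (\<Sum>i\<in>I. (c i)\<^sup>2)"
proof -
  have "integral {0..pi} (\<lambda>\<psi>. (\<Sum>i\<in>I. c i * eig i \<psi>) * (\<Sum>j\<in>I. c j * eig j \<psi>))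
      = integral {0..pi} (\<lambda>\<psi>. \<Sum>i\<in>I. \<Sum>j\<in>I. (c i * c j) * (eig i \<psi> * eig j \<psi>))"
    by (simp add: sum_product mult_ac)
  also have "\<dots> = (\<Sum>i\<in>I. \<Sum>j\<in>I. (c i * c j) * integral {0..pi} (\<lambda>\<psi>. eig i \<psi> * eig j \<psi>))"
    using assms
    by (subst integral_sum; (intro assms integrable_sum integrable_continuous_real continuous_intros)?)+
       (simp add: integral_sum integrable_continuous_real continuous_intros)
  finally have "inner_prod (\<lambda>\<psi>. \<Sum>i\<in>I. c i * eig i \<psi>) (\<lambda>\<psi>. \<Sum>i\<in>I. c i * eig i \<psi>)
      = (\<Sum>i\<in>I. \<Sum>j\<in>I. (c i * c j) * inner_prod (eig i) (eig j))"
    by (simp add: inner_prod_def sum_distrib_left mult_ac)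
  also have "\<dots> = (\<Sum>i\<in>I. (c i)\<^sup>2)"
    using assms by (simp add: inner_prod_eig power2_eq_square if_distrib cong: if_cong)
  finally show ?thesis .
qed

text \<open>By orthonormality the squared norm of the residual is a partial sum of the squares of
  the higher coefficients. It is nondecreasing, hence tends to 0 only if every one of them
  vanishes.\<close>

lemma has_eig_expansion_ground_iff:
  "has_eig_expansion (\<lambda>\<psi>. c 0 * eig 0 \<psi>) c \<longleftrightarrow> (\<forall>m\<ge>1. c m = 0)"
proof -
  define E where "E N = (let r = (\<lambda>\<psi>. c 0 * eig 0 \<psi> - (\<Sum>i<N. c i * eig i \<psi>)) in inner_prod r r)"
    for N
  \<comment> \<open>The index is shifted because the empty partial sum does not yet contain the
    ground term that cancels.\<close>
  have E: "E (Suc N) = (\<Sum>i\<in>{1..<Suc N}. (c i)\<^sup>2)" for N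
  proof -
    have "(\<Sum>i<Suc N. c i * eig i \<psi>) = c 0 * eig 0 \<psi> + (\<Sum>i\<in>{1..<Suc N}. c i * eig i \<psi>)" for \<psi>
      by (simp add: lessThan_atLeast0 sum.atLeast_Suc_lessThan)
    then have "E (Suc N) = inner_prod (\<lambda>\<psi>. \<Sum>i\<in>{1..<Suc N}. c i * eig i \<psi>)
        (\<lambda>\<psi>. \<Sum>i\<in>{1..<Suc N}. c i * eig i \<psi>)"
      by (simp add: E_def inner_prod_def)
    then show ?thesis by (simp only: inner_prod_sum_eig finite_atLeastLessThan)
  qed
  have "has_eig_expansion (\<lambda>\<psi>. c 0 * eig 0 \<psi>) c \<longleftrightarrow> (\<lambda>N. E (Suc N)) \<longlonglongrightarrow> 0"
    unfolding has_eig_expansion_def E_def[symmetric] by (rule filterlim_sequentially_Suc[symmetric])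
  also have "\<dots> \<longleftrightarrow> (\<forall>m\<ge>1. c m = 0)"
  proof (intro iffI allI impI)
    fix m :: nat assume lim: "(\<lambda>N. E (Suc N)) \<longlonglongrightarrow> 0" and m: "m \<ge> 1"
    have "(c m)\<^sup>2 \<le> E (Suc N)" if "N \<ge> m" for N
      unfolding E using m that by (intro member_le_sum) auto
    then have "(c m)\<^sup>2 \<le> 0" by (intro LIMSEQ_le_const[OF lim]) auto
    then show "c m = 0" by simp
  next
    assume "\<forall>m\<ge>1. c m = 0"
    then have "E (Suc N) = 0" for N unfolding E by (intro sum.neutral) auto
    then show "(\<lambda>N. E (Suc N)) \<longlonglongrightarrow> 0" by simp
  qed
  finally show ?thesis .
qed

section \<open>Free and periodically forced oscillators\<close>

text \<open>The difference \<open>z\<close> from the claimed solution conserves the energy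
  \<open>w\<^sup>2 * (z t)\<^sup>2 + (z' t)\<^sup>2\<close>, which is 0 at time 0.\<close>

lemma harmonic_oscillator_unique:
  fixes u u' :: "real \<Rightarrow> real"
  assumes u: "\<And>t. (u has_real_derivative u' t) (at t)"
    and u': "\<And>t. (u' has_real_derivative - (w\<^sup>2 * u t)) (at t)"
    and "u' 0 = 0" "w \<noteq> 0"
  shows "u t = u 0 * cos (w * t)"
proof -
  define z where "z t = u t - u 0 * cos (w * t)" for t
  define z' where "z' t = u' t + u 0 * w * sin (w * t)" for t
  have "\<exists>C. \<forall>t. w\<^sup>2 * (z t)\<^sup>2 + (z' t)\<^sup>2 = C"
  proof -
    have "((\<lambda>t. w\<^sup>2 * (z t)\<^sup>2 + (z' t)\<^sup>2) has_real_derivative 0) (at t)" for t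
      unfolding z_def z'_def
      by (rule derivative_eq_intros u u' refl)+ (simp add: algebra_simps power2_eq_square)
    then show ?thesis using DERIV_isconst_all by blast
  qed
  then obtain C where C: "w\<^sup>2 * (z t)\<^sup>2 + (z' t)\<^sup>2 = C" for t by blast
  have "C = 0" using C[of 0] assms(3) by (simp add: z_def z'_def)
  with C[of t] have "w\<^sup>2 * (z t)\<^sup>2 = 0"
    by (metis add_nonneg_eq_0_iff zero_le_power2 mult_nonneg_nonneg)
  with assms(4) show ?thesis by (simp add: z_def)
qed

text \<open>The integrand is the exact derivative of \<open>G\<close>, and \<open>G\<close> takes
  the same value at 0 and 2 pi when \<open>u\<close> is periodic. This turns the absence of secular
  terms into a vanishing resonant Fourier coefficient of the source.\<close>

lemma periodic_forcing_nonresonant: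
  fixes u u' S :: "real \<Rightarrow> real" and p :: int
  assumes u: "\<And>t. (u has_real_derivative u' t) (at t)"
    and u': "\<And>t. (u' has_real_derivative S t - (of_int p)\<^sup>2 * u t) (at t)"
    and per: "\<And>t. u (t + 2 * pi) = u t"
  shows "((\<lambda>t. S t * cos (of_int p * t)) has_integral 0) {0..2 * pi}"
proof -
  define G where "G t = u' t * cos (of_int p * t) + of_int p * u t * sin (of_int p * t)" for t
  \<comment> \<open>Only \<open>u\<close> is assumed periodic; uniqueness of the derivative carries
    this over to \<open>u'\<close>.\<close>
  have "((\<lambda>t. u (t + 2 * pi)) has_real_derivative u' (0 + 2 * pi)) (at 0)"
    using u[of "0 + 2 * pi"] unfolding DERIV_shift .
  then have "(u has_real_derivative u' (2 * pi)) (at 0)" by (simp add: per)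
  then have "u' (2 * pi) = u' 0" using u DERIV_unique by blast
  moreover have "cos (of_int p * (2 * pi)) = 1" "sin (of_int p * (2 * pi)) = 0"
    using cos_int_2pin[of p] sin_int_2pin[of p] by (simp_all add: mult_ac)
  ultimately have "G (2 * pi) = G 0" by (simp add: G_def)
  moreover have "((\<lambda>t. S t * cos (of_int p * t)) has_integral (G (2 * pi) - G 0)) {0..2 * pi}"
  proof (rule fundamental_theorem_of_calculus)
    fix t :: real
    have "(G has_real_derivative S t * cos (of_int p * t)) (at t)"
      unfolding G_def
      by (rule derivative_eq_intros u u' refl)+ (simp add: algebra_simps power2_eq_square)
    then show "(G has_vector_derivative S t * cos (of_int p * t)) (at t within {0..2 * pi})"
      by (simp add: has_real_derivative_iff_has_vector_derivative has_vector_derivative_at_within)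
  qed simp
  ultimately show ?thesis by simp
qed


section \<open>The index sums in the source\<close>

lemma sum_theta_index:
  fixes h :: "nat \<Rightarrow> nat \<Rightarrow> 'a::comm_monoid_add"
  shows "(\<Sum>(\<mu>, \<nu>) \<in> {(\<mu>, \<nu>). 1 \<le> \<nu> \<and> \<mu> + \<nu> = n}. h \<mu> \<nu>) = (\<Sum>\<nu>=1..n. h (n - \<nu>) \<nu>)"
  by (rule sum.reindex_bij_witness[where i = "\<lambda>\<nu>. (n - \<nu>, \<nu>)" and j = snd]) auto

lemma source_eq:
  "source \<theta> f n m t = - infsum (cubic_term f n m t) UNIV - (\<Sum>\<nu>=1..n. \<theta> \<nu> * deriv (deriv (f (n - \<nu>) m)) t)"
  unfolding source_def sum_theta_index[where h = "\<lambda>\<mu> \<nu>. \<theta> \<nu> * deriv (deriv (f \<mu> m)) t"] ..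

abbreviation cubic_index :: "nat \<Rightarrow> (nat \<times> nat \<times> nat) set" where
  "cubic_index n \<equiv> {(\<mu>, \<nu>, \<rho>). 1 \<le> \<mu> \<and> 1 \<le> \<nu> \<and> 1 \<le> \<rho> \<and> \<mu> + \<nu> + \<rho> = n}"

lemma finite_cubic_index: "finite (cubic_index n)"
  by (rule finite_subset[of _ "{..n} \<times> {..n} \<times> {..n}"]) auto

lemma cubic_index_singleton_sum:
  fixes h :: "nat \<Rightarrow> nat \<Rightarrow> nat \<Rightarrow> 'a::comm_monoid_add"
  assumes "(\<mu>', \<nu>', \<rho>') \<in> cubic_index n"
    and "\<And>\<mu> \<nu> \<rho>. (\<mu>, \<nu>, \<rho>) \<in> cubic_index n \<Longrightarrow> (\<mu>, \<nu>, \<rho>) \<noteq> (\<mu>', \<nu>', \<rho>') \<Longrightarrow> h \<mu> \<nu> \<rho> = 0"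
  shows "(\<Sum>(\<mu>, \<nu>, \<rho>) \<in> cubic_index n. h \<mu> \<nu> \<rho>) = h \<mu>' \<nu>' \<rho>'"
proof -
  have "(\<Sum>(\<mu>, \<nu>, \<rho>) \<in> cubic_index n. h \<mu> \<nu> \<rho>) = (\<Sum>(\<mu>, \<nu>, \<rho>) \<in> {(\<mu>', \<nu>', \<rho>')}. h \<mu> \<nu> \<rho>)"
  proof (intro sum.mono_neutral_right finite_cubic_index ballI)
    fix x assume "x \<in> cubic_index n - {(\<mu>', \<nu>', \<rho>')}"
    then show "(case x of (\<mu>, \<nu>, \<rho>) \<Rightarrow> h \<mu> \<nu> \<rho>) = 0"
      using assms(2)[of "fst x" "fst (snd x)" "snd (snd x)"] by (cases x) simp
  qed (use assms(1) in simp)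
  then show ?thesis by simp
qed

text \<open>Only finitely many mode triples contribute in every case below, so the infinite sums of
  the source become finite ones.\<close>

lemma infsum_finite_support:
  fixes g :: "'a \<Rightarrow> real"
  assumes "finite F" "\<And>x. x \<notin> F \<Longrightarrow> g x = 0"
  shows "g summable_on UNIV" "infsum g UNIV = sum g F"
proof -
  have "(g has_sum sum g F) UNIV"
    using assms by (intro has_sum_finite_neutralI[of F]) auto
  then show "g summable_on UNIV" "infsum g UNIV = sum g F"
    by (auto simp: summable_on_def infsumI)
qed

lemma deriv_deriv_cos: "deriv (deriv cos) t = - cos (t::real)"
proof -
  have "deriv cos = (\<lambda>t::real. - sin t)"
    by (rule ext, rule DERIV_imp_deriv) (auto intro!: derivative_eq_intros)
  moreover have "deriv (\<lambda>t::real. - sin t) t = - cos t"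
    by (rule DERIV_imp_deriv) (auto intro!: derivative_eq_intros)
  ultimately show ?thesis by simp
qed

section \<open>Necessity: periodicity forces the higher modes to vanish\<close>

context
  fixes \<theta> :: "nat \<Rightarrow> real" and a :: "nat \<Rightarrow> nat \<Rightarrow> real" and f :: "nat \<Rightarrow> nat \<Rightarrow> real \<Rightarrow> real"
  assumes sol: "resonant_solution \<theta> a f"
begin

lemma resonant_solution_derivs:
  "(f n m has_real_derivative deriv (f n m) t) (at t)"
  "n \<ge> 2 \<Longrightarrow> (deriv (f n m) has_real_derivative source \<theta> f n m t - (eig_freq m)\<^sup>2 * f n m t) (at t)"
proof -
  have d: "f n m differentiable_on UNIV" "deriv (f n m) differentiable_on UNIV"
    using sol unfolding resonant_solution_def by blast+
  then show "(f n m has_real_derivative deriv (f n m) t) (at t)"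
    by (simp add: differentiable_on_def DERIV_deriv_iff_real_differentiable)
  assume "n \<ge> 2"
  then have "deriv (deriv (f n m)) t + (eig_freq m)\<^sup>2 * f n m t = source \<theta> f n m t"
    using sol unfolding resonant_solution_def by blast
  then have "source \<theta> f n m t - (eig_freq m)\<^sup>2 * f n m t = deriv (deriv (f n m)) t" by simp
  with d show "(deriv (f n m) has_real_derivative source \<theta> f n m t - (eig_freq m)\<^sup>2 * f n m t) (at t)"
    by (simp add: differentiable_on_def DERIV_deriv_iff_real_differentiable)
qed

lemma resonant_solution_0_1: "f 0 m = (\<lambda>_. 0)" "f (Suc 0) m = (if m = 0 then cos else (\<lambda>_. 0))"
  using sol by (auto simp: resonant_solution_def fun_eq_iff)

context
  assumes nst: "no_secular_term f"
begin

lemma source_nonresonant: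
  assumes "n \<ge> 2"
  shows "((\<lambda>t. source \<theta> f n m t * cos (of_int (int m + 1) * t)) has_integral 0) {0..2 * pi}"
proof (rule periodic_forcing_nonresonant[of "f n m" "deriv (f n m)"])
  show "(deriv (f n m) has_real_derivative source \<theta> f n m t - (of_int (int m + 1))\<^sup>2 * f n m t) (at t)" for t
    using resonant_solution_derivs(2)[OF assms, of m t] by (simp add: eig_freq_def)
qed (use nst assms resonant_solution_derivs in \<open>auto simp: no_secular_term_def\<close>)

text \<open>No three positive orders add up to 2, so the ground-mode source of order 2 is just
  \<open>\<theta> 1 * cos t\<close>, which is resonant.\<close>

lemma theta_1: "\<theta> 1 = 0"
proof -
  have ind: "cubic_index 2 = {}" by auto
  have "cubic_term f 2 0 t (i, j, k) = 0" for t i j k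
    unfolding cubic_term_def case_prod_conv ind by simp
  then have "infsum (cubic_term f 2 0 t) UNIV = 0" for t
    by (intro infsum_0) (simp add: split_paired_all)
  then have "source \<theta> f 2 0 t = \<theta> 1 * cos t" for t
    unfolding source_eq by (simp add: resonant_solution_0_1 deriv_deriv_cos numeral_2_eq_2)
  then have "((\<lambda>t. \<theta> 1 * (cos (of_int 1 * t) * cos (of_int 1 * t))) has_integral 0) {0..2 * pi}"
    using source_nonresonant[of 2 0] by (simp add: mult.assoc)
  moreover have "((\<lambda>t. \<theta> 1 * (cos (of_int 1 * t) * cos (of_int 1 * t))) has_integral \<theta> 1 * pi) {0..2 * pi}"
    using has_integral_mult_right[OF has_integral_cos_cos[of 1 1], of "\<theta> 1"] by simp
  ultimately have "\<theta> 1 * pi = 0" using has_integral_unique by blast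
  then show ?thesis by simp
qed

text \<open>At order 3 the only cubic contribution is cos^3 = (3/4) cos t + (1/4) cos 3t, and its
  resonant part has to be balanced by \<open>\<theta> 2 * cos t\<close>.\<close>

lemma theta_2: "\<theta> 2 = 3 / 4"
proof -
  have ind: "cubic_index 3 = {(1, 1, 1)}" by auto
  have cub: "cubic_term f 3 0 t (i, j, k) = (if (i, j, k) = (0, 0, 0) then cos t ^ 3 else 0)" for t i j k
    unfolding cubic_term_def case_prod_conv ind
    by (simp add: interaction_coeff_0_0 resonant_solution_0_1 power3_eq_cube)
  have "infsum (cubic_term f 3 0 t) UNIV = sum (cubic_term f 3 0 t) {(0, 0, 0)}" for t
    by (rule infsum_finite_support) (auto simp: cub split: if_splits)
  then have inf: "infsum (cubic_term f 3 0 t) UNIV = cos t ^ 3" for t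
    by (simp add: cub)
  have src: "source \<theta> f 3 0 t = (\<theta> 2 - 3 / 4) * cos (of_int 1 * t) - 1 / 4 * cos (of_int 3 * t)" for t
  proof -
    have "source \<theta> f 3 0 t = \<theta> 2 * cos t - cos t ^ 3"
      unfolding source_eq inf
      by (simp add: resonant_solution_0_1 deriv_deriv_cos theta_1[simplified] numeral_3_eq_3 numeral_2_eq_2)
    then show ?thesis using cos_treble_cos[of t] by (simp add: field_simps)
  qed
  have eq: "source \<theta> f 3 0 t * cos (of_int 1 * t) = (\<theta> 2 - 3 / 4) * (cos (of_int 1 * t) * cos (of_int 1 * t))
      - 1 / 4 * (cos (of_int 3 * t) * cos (of_int 1 * t))" for t
    by (simp only: src left_diff_distrib right_diff_distrib mult.assoc)
  have "((\<lambda>t. source \<theta> f 3 0 t * cos (of_int 1 * t)) has_integral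
      (\<theta> 2 - 3 / 4) * (if (1::int) = 1 \<or> (1::int) = - 1 then pi else 0)
      - 1 / 4 * (if (3::int) = 1 \<or> (3::int) = - 1 then pi else 0)) {0..2 * pi}"
    unfolding eq by (intro has_integral_diff has_integral_mult_right has_integral_cos_cos) simp_all
  moreover have "((\<lambda>t. source \<theta> f 3 0 t * cos (of_int 1 * t)) has_integral 0) {0..2 * pi}"
    using source_nonresonant[of 3 0] by simp
  ultimately have "(\<theta> 2 - 3 / 4) * (if (1::int) = 1 \<or> (1::int) = - 1 then pi else 0)
      - 1 / 4 * (if (3::int) = 1 \<or> (3::int) = - 1 then pi else 0) = 0"
    by (rule has_integral_unique)
  then show ?thesis by simp
qed

lemma higher_mode_vanishes_step:
  assumes N: "N \<ge> 2" and m: "m \<ge> 1"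
    and below: "\<And>n m. n < N \<Longrightarrow> m \<ge> 1 \<Longrightarrow> f n m = (\<lambda>_. 0)"
  shows "f N m = (\<lambda>_. 0)"
proof -
  define p where "p = int m + 1"
  have p: "eig_freq m = of_int p" "p \<ge> 2" using m by (auto simp: p_def eig_freq_def)
  \<comment> \<open>All three orders are below \<open>N\<close>, so any factor in a higher mode is
    0; the triple of ground modes has coefficient 0 because \<open>m\<close> is at least 1.\<close>
  have "cubic_term f N m t (i, j, k) = 0" for t i j k
  proof (cases "i = 0 \<and> j = 0 \<and> k = 0")
    case True
    then show ?thesis using m by (simp add: cubic_term_def interaction_coeff_0_0)
  next
    case False
    have "f \<mu> i t * f \<nu> j t * f \<rho> k t = 0" if "(\<mu>, \<nu>, \<rho>) \<in> cubic_index N" for \<mu> \<nu> \<rho>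
    proof -
      have "\<mu> < N" "\<nu> < N" "\<rho> < N" using that by auto
      then show ?thesis using False below[of \<mu> i] below[of \<nu> j] below[of \<rho> k] by auto
    qed
    then show ?thesis by (auto simp: cubic_term_def intro!: sum.neutral)
  qed
  then have "infsum (cubic_term f N m t) UNIV = 0" for t
    by (intro infsum_0) (simp add: split_paired_all)
  moreover have "\<theta> \<nu> * deriv (deriv (f (N - \<nu>) m)) t = 0" if "\<nu> \<in> {1..N}" for \<nu> t
    using that m below[of "N - \<nu>" m] by simp
  ultimately have source_N: "source \<theta> f N m t = 0" for t
    unfolding source_eq by (simp only: sum.neutral_const cong: sum.cong)
  define A where "A = f N m 0"
  have fN: "f N m t = A * cos (of_int p * t)" for t
    unfolding A_def
  proof (rule harmonic_oscillator_unique[of _ "deriv (f N m)"])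
    show "(deriv (f N m) has_real_derivative - ((of_int p)\<^sup>2 * f N m t)) (at t)" for t
      using resonant_solution_derivs(2)[OF N, of m t] source_N by (simp add: p)
    show "deriv (f N m) 0 = 0" using sol by (simp add: resonant_solution_def)
  qed (use p resonant_solution_derivs in auto)
  have ddN: "deriv (deriv (f N m)) t = - (of_int p)\<^sup>2 * f N m t" for t
    using DERIV_imp_deriv[OF resonant_solution_derivs(2)[OF N, of m t]] by (simp add: source_N p)

  \<comment> \<open>With two ground modes in a triple, the delta identity leaves only those whose
    third entry is \<open>m\<close>.\<close>
  define F where "F = {(m, 0::nat, 0::nat), (0, m, 0), (0, 0, m)}"
  have off: "cubic_term f (N + 2) m t (i, j, k) = 0" if "(i, j, k) \<notin> F" for t i j k
  proof (cases "(i = 0 \<and> j = 0) \<or> (i = 0 \<and> k = 0) \<or> (j = 0 \<and> k = 0)")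
    case True
    then have "interaction_coeff i j k m = 0"
      using that m by (auto simp: interaction_coeff_0_0 F_def)
    then show ?thesis by (simp add: cubic_term_def)
  next
    case False
    have "f \<mu> i t * f \<nu> j t * f \<rho> k t = 0" if "(\<mu>, \<nu>, \<rho>) \<in> cubic_index (N + 2)" for \<mu> \<nu> \<rho>
    proof -
      \<comment> \<open>Two orders of size at least \<open>N\<close> and a third of at least 1 would
        exceed \<open>N + 2\<close>. Hence two of the orders are below \<open>N\<close>, and as at
        most one of the three modes is the ground mode, one of these two factors is 0.\<close>
      have "\<mu> < N \<and> \<nu> < N \<or> \<mu> < N \<and> \<rho> < N \<or> \<nu> < N \<and> \<rho> < N" using that N by auto
      then show ?thesis using False below[of \<mu> i] below[of \<nu> j] below[of \<rho> k] by auto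
    qed
    then show ?thesis by (auto simp: cubic_term_def intro!: sum.neutral)
  qed
  have on: "cubic_term f (N + 2) m t ijk = f N m t * (cos t)\<^sup>2" if "ijk \<in> F" for t ijk
  proof -
    \<comment> \<open>The factor in mode \<open>m\<close> survives only at orders from
      \<open>N\<close> on. Since the other two orders are at least 1, the split must be
      \<open>N\<close>, 1, 1.\<close>
    have "(\<Sum>(\<mu>, \<nu>, \<rho>) \<in> cubic_index (N + 2). f \<mu> m t * f \<nu> 0 t * f \<rho> 0 t)
        = f N m t * f 1 0 t * f 1 0 t"
      using m N below[of _ m] by (intro cubic_index_singleton_sum) auto
    moreover have "(\<Sum>(\<mu>, \<nu>, \<rho>) \<in> cubic_index (N + 2). f \<mu> 0 t * f \<nu> m t * f \<rho> 0 t)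
        = f 1 0 t * f N m t * f 1 0 t"
      using m N below[of _ m] by (intro cubic_index_singleton_sum) auto
    moreover have "(\<Sum>(\<mu>, \<nu>, \<rho>) \<in> cubic_index (N + 2). f \<mu> 0 t * f \<nu> 0 t * f \<rho> m t)
        = f 1 0 t * f 1 0 t * f N m t"
      using m N below[of _ m] by (intro cubic_index_singleton_sum) auto
    ultimately show ?thesis
      using that by (auto simp: cubic_term_def F_def interaction_coeff_0_0 resonant_solution_0_1
        power2_eq_square)
  qed
  have "infsum (cubic_term f (N + 2) m t) UNIV = sum (cubic_term f (N + 2) m t) F" for t
  proof (rule infsum_finite_support)
    show "cubic_term f (N + 2) m t x = 0" if "x \<notin> F" for x
      using that by (cases x) (simp only: off not_False_eq_True)
  qed (simp add: F_def)
  moreover have "card F = 3" using m by (simp add: F_def)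
  ultimately have inf: "infsum (cubic_term f (N + 2) m t) UNIV = 3 * (f N m t * (cos t)\<^sup>2)" for t
    using on by simp
  have theta: "(\<Sum>\<nu>=1..N + 2. \<theta> \<nu> * deriv (deriv (f (N + 2 - \<nu>) m)) t)
      = \<theta> 2 * deriv (deriv (f N m)) t" for t
  proof -
    have "(\<Sum>\<nu>=1..N + 2. \<theta> \<nu> * deriv (deriv (f (N + 2 - \<nu>) m)) t)
        = (\<Sum>\<nu>\<in>{2}. \<theta> \<nu> * deriv (deriv (f (N + 2 - \<nu>) m)) t)"
    proof (intro sum.mono_neutral_right ballI)
      fix \<nu> assume "\<nu> \<in> {1..N + 2} - {2}"
      \<comment> \<open>The shift with index 1 is 0 by \<open>theta_1\<close>, and indices from 3 on
        meet coefficients of order below \<open>N\<close>.\<close>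
      then have "\<nu> = 1 \<or> N + 2 - \<nu> < N" by auto
      then show "\<theta> \<nu> * deriv (deriv (f (N + 2 - \<nu>) m)) t = 0"
        using theta_1 m below[of "N + 2 - \<nu>" m] by auto
    qed auto
    then show ?thesis by simp
  qed
  have "source \<theta> f (N + 2) m t = 3 / 4 * (of_int p)\<^sup>2 * f N m t - 3 * (f N m t * (cos t)\<^sup>2)" for t
    unfolding source_eq inf theta ddN theta_2 by simp
  \<comment> \<open>Here 3 cos^2 t = 3/2 + (3/2) cos 2t: the constant part lowers the resonant
    coefficient, while the oscillating part moves the frequency to \<open>p + 2\<close> and
    \<open>p - 2\<close>.\<close>
  also have "3 / 4 * (of_int p)\<^sup>2 * f N m t - 3 * (f N m t * (cos t)\<^sup>2)
      = 3 / 4 * A * (((of_int p)\<^sup>2 - 2) * cos (of_int p * t)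
          - cos (of_int (p + 2) * t) - cos (of_int (p - 2) * t))" for t
  proof -
    have "cos (of_int (p + 2) * t) + cos (of_int (p - 2) * t) = 2 * cos (of_int p * t) * cos (2 * t)"
      by (simp add: cos_add cos_diff algebra_simps)
    also have "\<dots> = 2 * cos (of_int p * t) * (2 * (cos t)\<^sup>2 - 1)"
      by (simp add: cos_double_cos)
    finally have "cos (of_int (p + 2) * t) = 2 * cos (of_int p * t) * (2 * (cos t)\<^sup>2 - 1)
        - cos (of_int (p - 2) * t)" by simp
    then show ?thesis unfolding fN by (simp add: algebra_simps)
  qed
  finally have src: "source \<theta> f (N + 2) m t = 3 / 4 * A * (((of_int p)\<^sup>2 - 2) * cos (of_int p * t)
          - cos (of_int (p + 2) * t) - cos (of_int (p - 2) * t))" for t .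
  have eq: "source \<theta> f (N + 2) m t * cos (of_int p * t) =
      3 / 4 * A * (((of_int p)\<^sup>2 - 2) * (cos (of_int p * t) * cos (of_int p * t))
          - cos (of_int (p + 2) * t) * cos (of_int p * t) - cos (of_int (p - 2) * t) * cos (of_int p * t))"
    for t by (simp only: src left_diff_distrib right_diff_distrib mult.assoc)
  have "((\<lambda>t. source \<theta> f (N + 2) m t * cos (of_int p * t)) has_integral
      3 / 4 * A * (((of_int p)\<^sup>2 - 2) * (if p = p \<or> p = - p then pi else 0)
      - (if p + 2 = p \<or> p + 2 = - p then pi else 0)
      - (if p - 2 = p \<or> p - 2 = - p then pi else 0))) {0..2 * pi}"
    unfolding eq using p by (intro has_integral_diff has_integral_mult_right has_integral_cos_cos) simp_all
  moreover have "((\<lambda>t. source \<theta> f (N + 2) m t * cos (of_int p * t)) has_integral 0) {0..2 * pi}"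
    using source_nonresonant[of "N + 2" m] by (simp add: p_def)
  ultimately have "3 / 4 * A * (((of_int p)\<^sup>2 - 2) * (if p = p \<or> p = - p then pi else 0)
      - (if p + 2 = p \<or> p + 2 = - p then pi else 0)
      - (if p - 2 = p \<or> p - 2 = - p then pi else 0)) = 0"
    by (rule has_integral_unique)
  \<comment> \<open>For \<open>p\<close> at least 2 neither side frequency is \<open>p\<close> or
    \<open>- p\<close>. In the ground mode, \<open>p = 1\<close>, the frequency \<open>p - 2\<close>
    would be resonant.\<close>
  then have "A * ((of_int p)\<^sup>2 - 2) = 0" using p by (auto split: if_splits)
  moreover have "(of_int p)\<^sup>2 \<ge> (2::real)\<^sup>2" using p by (intro power_mono) auto
  ultimately have "A = 0" by auto
  then show ?thesis using fN by auto
qed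

lemma higher_modes_vanish:
  assumes "m \<ge> 1"
  shows "f n m = (\<lambda>_. 0)"
  using assms
proof (induction n arbitrary: m rule: less_induct)
  case (less n)
  show ?case
  proof (cases "n \<ge> 2")
    case True
    then show ?thesis using less higher_mode_vanishes_step by blast
  next
    case False
    then have "n = 0 \<or> n = Suc 0" by auto
    then show ?thesis using less.prems by (auto simp: resonant_solution_0_1)
  qed
qed

end

end


section \<open>Even trigonometric polynomials\<close>

text \<open>The real span of the functions cos(jt). Periodicity and zero initial velocity are built
  in, and rule induction reduces linear claims to a single mode.\<close>

inductive_set cos_polys :: "(real \<Rightarrow> real) set" where
  mode: "(\<lambda>t. c * cos (real j * t)) \<in> cos_polys"
| add: "f \<in> cos_polys \<Longrightarrow> g \<in> cos_polys \<Longrightarrow> (\<lambda>t. f t + g t) \<in> cos_polys"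

lemma cos_polys_zero: "(\<lambda>_. 0) \<in> cos_polys"
  using cos_polys.mode[of 0 0] by simp

lemma cos_polys_cos: "cos \<in> cos_polys"
  using cos_polys.mode[of 1 1] by simp

lemma cos_polys_cmult: "f \<in> cos_polys \<Longrightarrow> (\<lambda>t. c * f t) \<in> cos_polys"
proof (induction rule: cos_polys.induct)
  case (mode d j)
  then show ?case using cos_polys.mode[of "c * d" j] by (simp add: mult.assoc)
qed (simp add: distrib_left cos_polys.add)

lemma cos_polys_diff: "f \<in> cos_polys \<Longrightarrow> g \<in> cos_polys \<Longrightarrow> (\<lambda>t. f t - g t) \<in> cos_polys"
  using cos_polys.add[OF _ cos_polys_cmult[of g "-1"], of f] by simp

lemma cos_polys_sum: "(\<And>x. x \<in> A \<Longrightarrow> f x \<in> cos_polys) \<Longrightarrow> (\<lambda>t. \<Sum>x\<in>A. f x t) \<in> cos_polys"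
  by (induction A rule: infinite_finite_induct) (auto simp: cos_polys_zero cos_polys.add)

lemma cos_polys_mult:
  assumes "f \<in> cos_polys" "g \<in> cos_polys"
  shows "(\<lambda>t. f t * g t) \<in> cos_polys"
  using assms
proof (induction arbitrary: g rule: cos_polys.induct)
  case (mode c j)
  then show ?case
  proof (induction rule: cos_polys.induct)
    case (mode d k)
    \<comment> \<open>Evenness of cosine replaces the difference frequency by a natural number, as
      membership in \<open>cos_polys\<close> demands.\<close>
    have "cos ((real j - real k) * t) = cos (real (if k \<le> j then j - k else k - j) * t)" for t
      using cos_minus[of "(real j - real k) * t"] by (auto simp: of_nat_diff algebra_simps)
    then have "c * cos (real j * t) * (d * cos (real k * t)) =
        (c * d / 2) * cos (real (if k \<le> j then j - k else k - j) * t) + (c * d / 2) * cos (real (j + k) * t)"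
      for t by (simp add: cos_times_cos algebra_simps add_divide_distrib)
    then show ?case by (simp only: cos_polys.mode cos_polys.add)
  qed (simp add: distrib_left cos_polys.add)
qed (simp add: distrib_right cos_polys.add)

lemma cos_polys_periodic: "f \<in> cos_polys \<Longrightarrow> f (t + 2 * pi) = f t"
proof (induction rule: cos_polys.induct)
  case (mode c j)
  have "cos (real j * (t + 2 * pi)) = cos (real j * t + real (2 * j) * pi)"
    by (simp add: algebra_simps)
  also have "\<dots> = cos (real j * t)" by (simp only: cos_add sin_npi cos_npi) simp
  finally show ?case by simp
qed simp

lemma cos_polys_derivs:
  assumes "f \<in> cos_polys"
  shows "f differentiable_on UNIV" "deriv f differentiable_on UNIV" "deriv f 0 = 0"
    "deriv (deriv f) \<in> cos_polys"
proof -
  \<comment> \<open>The induction carries explicit derivatives, since \<open>deriv\<close> is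
    additive only once differentiability is known.\<close>
  have "\<exists>f1. \<exists>f2\<in>cos_polys. (\<forall>t. (f has_real_derivative f1 t) (at t)) \<and>
      (\<forall>t. (f1 has_real_derivative f2 t) (at t)) \<and> f1 0 = 0"
    using assms
  proof (induction rule: cos_polys.induct)
    case (mode c j)
    show ?case
    proof (intro exI bexI conjI allI)
      show "((\<lambda>t. c * cos (real j * t)) has_real_derivative - c * real j * sin (real j * t)) (at t)" for t
        by (auto intro!: derivative_eq_intros)
      show "((\<lambda>t. - c * real j * sin (real j * t)) has_real_derivative
          (- c * real j * real j) * cos (real j * t)) (at t)" for t
        by (auto intro!: derivative_eq_intros)
    qed (simp_all add: cos_polys.mode[of "- c * real j * real j", simplified])
  next
    case (add f g)
    then obtain f1 f2 g1 g2 where "f2 \<in> cos_polys" "g2 \<in> cos_polys" "f1 0 = 0" "g1 0 = 0"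
      "\<And>t. (f has_real_derivative f1 t) (at t)" "\<And>t. (f1 has_real_derivative f2 t) (at t)"
      "\<And>t. (g has_real_derivative g1 t) (at t)" "\<And>t. (g1 has_real_derivative g2 t) (at t)"
      by blast
    then show ?case
      by (intro exI[of _ "\<lambda>t. f1 t + g1 t"] bexI[of _ "\<lambda>t. f2 t + g2 t"])
        (auto intro: DERIV_add cos_polys.add)
  qed
  then obtain f1 f2 where "f2 \<in> cos_polys" "f1 0 = 0"
    and d: "\<And>t. (f has_real_derivative f1 t) (at t)" "\<And>t. (f1 has_real_derivative f2 t) (at t)"
    by blast
  moreover from d have "deriv f = f1" "deriv f1 = f2" by (auto simp: fun_eq_iff DERIV_imp_deriv)
  ultimately show "f differentiable_on UNIV" "deriv f differentiable_on UNIV" "deriv f 0 = 0"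
      "deriv (deriv f) \<in> cos_polys"
    by (auto simp: differentiable_on_def real_differentiable_def)
qed

lemma deriv_deriv_lincomb:
  assumes "f \<in> cos_polys" "g \<in> cos_polys"
  shows "deriv (deriv (\<lambda>t. f t + c * g t)) t = deriv (deriv f) t + c * deriv (deriv g) t"
proof -
  have d: "(h has_real_derivative deriv h t) (at t)"
    "(deriv h has_real_derivative deriv (deriv h) t) (at t)" if "h \<in> cos_polys" for h t
    using cos_polys_derivs[OF that]
    by (simp_all add: differentiable_on_def DERIV_deriv_iff_real_differentiable)
  have "deriv (\<lambda>t. f t + c * g t) = (\<lambda>t. deriv f t + c * deriv g t)"
    by (rule ext, rule DERIV_imp_deriv) (intro DERIV_add DERIV_cmult d assms)
  then show ?thesis
    by (simp only:, intro DERIV_imp_deriv DERIV_add DERIV_cmult d assms)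
qed

lemma deriv_deriv_mode:
  "deriv (deriv (\<lambda>t. c * cos (w * t))) t = - (c * w\<^sup>2 * cos (w * t))" for t :: real
proof -
  have "deriv (\<lambda>t. c * cos (w * t)) = (\<lambda>t. - c * w * sin (w * t))"
    by (rule ext, rule DERIV_imp_deriv) (auto intro!: derivative_eq_intros)
  moreover have "deriv (\<lambda>t. - c * w * sin (w * t)) t = - (c * w\<^sup>2 * cos (w * t))"
    by (rule DERIV_imp_deriv) (auto intro!: derivative_eq_intros simp: power2_eq_square)
  ultimately show ?thesis by simp
qed

section \<open>Sufficiency: the Poincare-Lindstedt construction\<close>

text \<open>A forcing mode cos(jt) with \<open>j\<close> other than 1 is inverted by dividing by 1 -
  j^2; the resonant mode is cancelled by the free constant \<open>c\<close>. Adding a multiple of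
  the homogeneous solution cos then adjusts the initial value.\<close>

lemma forced_oscillator_detuned:
  assumes "S \<in> cos_polys"
  shows "\<exists>c. \<exists>g\<in>cos_polys. g 0 = v \<and> (\<forall>t. deriv (deriv g) t + g t = S t + c * cos t)"
proof -
  have "\<exists>c. \<exists>g\<in>cos_polys. \<forall>t. deriv (deriv g) t + g t = S t + c * cos t"
    using assms
  proof (induction rule: cos_polys.induct)
    case (mode d j)
    show ?case
    proof (cases "j = 1")
      case True
      then show ?thesis by (intro exI[of _ "- d"] bexI[OF _ cos_polys_zero]) simp
    next
      case False
      define e where "e = d / (1 - (real j)\<^sup>2)"
      from False have d: "d = e * (1 - (real j)\<^sup>2)" by (simp add: e_def power2_eq_1_iff)
      have "- (e * (real j)\<^sup>2 * x) + e * x = d * x" for x unfolding d by (simp add: algebra_simps)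
      then show ?thesis
        by (intro exI[of _ 0] bexI[OF _ cos_polys.mode[of e j]]) (simp add: deriv_deriv_mode)
    qed
  next
    case (add S1 S2)
    then obtain c1 g1 c2 g2 where g: "g1 \<in> cos_polys" "g2 \<in> cos_polys"
      and e: "\<And>t. deriv (deriv g1) t + g1 t = S1 t + c1 * cos t"
        "\<And>t. deriv (deriv g2) t + g2 t = S2 t + c2 * cos t" by blast
    show ?case
    proof (intro exI bexI allI)
      show "(\<lambda>t. g1 t + 1 * g2 t) \<in> cos_polys" using g by (simp add: cos_polys.add)
      show "deriv (deriv (\<lambda>t. g1 t + 1 * g2 t)) t + (g1 t + 1 * g2 t)
          = S1 t + S2 t + (c1 + c2) * cos t" for t
        unfolding deriv_deriv_lincomb[OF g] using e[of t] by (simp add: algebra_simps)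
    qed
  qed
  then obtain c g where g: "g \<in> cos_polys" and e: "\<And>t. deriv (deriv g) t + g t = S t + c * cos t"
    by blast
  define b where "b = v - g 0"
  show ?thesis
  proof (intro exI bexI conjI allI)
    show "(\<lambda>t. g t + b * cos t) \<in> cos_polys"
      by (intro cos_polys.add g cos_polys_cmult cos_polys_cos)
    show "g 0 + b * cos 0 = v" by (simp add: b_def)
    show "deriv (deriv (\<lambda>t. g t + b * cos t)) t + (g t + b * cos t) = S t + c * cos t" for t
      unfolding deriv_deriv_lincomb[OF g cos_polys_cos] deriv_deriv_cos using e[of t] by simp
  qed
qed

text \<open>Order by order, the shift \<open>\<theta> (n - 1)\<close> multiplies the second derivative of the first-order
  term \<open>cos\<close> and can therefore cancel the only resonant mode in the source of order \<open>n\<close>.\<close>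

lemma duffing_expansion:
  assumes "v 0 = 0" "v (Suc 0) = 1"
  obtains g :: "nat \<Rightarrow> real \<Rightarrow> real" and \<theta> :: "nat \<Rightarrow> real"
  where "\<theta> 0 = 1" "\<And>n. g n \<in> cos_polys" "\<And>n. g n 0 = v n" "g 0 = (\<lambda>_. 0)" "g (Suc 0) = cos"
    "\<And>n t. n \<ge> 2 \<Longrightarrow> deriv (deriv (g n)) t + g n t =
       - (\<Sum>(\<mu>, \<nu>, \<rho>) \<in> cubic_index n. g \<mu> t * g \<nu> t * g \<rho> t)
       - (\<Sum>\<nu>=1..n. \<theta> \<nu> * deriv (deriv (g (n - \<nu>))) t)"
proof -
  \<comment> \<open>\<open>q n\<close> pairs the coefficient of order \<open>n\<close> with the
    constant that removes its resonance, the future \<open>\<theta> (n - 1)\<close>. The sum stops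
    at \<open>n - 2\<close>: the next shift is the one being chosen, and the last one multiplies the
    zero function of order 0.\<close>
  define R where "R q n t = - (\<Sum>(\<mu>, \<nu>, \<rho>) \<in> cubic_index n. fst (q \<mu>) t * fst (q \<nu>) t * fst (q \<rho>) t)
       - (\<Sum>\<nu>=1..n - 2. snd (q (Suc \<nu>)) * deriv (deriv (fst (q (n - \<nu>)))) t)"
    for q :: "nat \<Rightarrow> (real \<Rightarrow> real) \<times> real" and n t
  define P where "P q n r \<longleftrightarrow> fst r \<in> cos_polys \<and> fst r 0 = v n \<and>
      (n = 0 \<longrightarrow> fst r = (\<lambda>_. 0)) \<and> (n = Suc 0 \<longrightarrow> fst r = cos) \<and>
      (n \<ge> 2 \<longrightarrow> (\<forall>t. deriv (deriv (fst r)) t + fst r t = R q n t + snd r * cos t))"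
    for q n r
  \<comment> \<open>\<open>R q n\<close> reads \<open>q\<close> only below \<open>n\<close>, so the
    pairs can be chosen by well-founded recursion on the order.\<close>
  have "\<exists>q. \<forall>n. P q n (q n)"
  proof (rule dependent_wf_choice[OF wf_less])
    fix q q' :: "nat \<Rightarrow> (real \<Rightarrow> real) \<times> real" and n r
    assume eq: "\<And>k. (k, n) \<in> {(x, y). x < y} \<Longrightarrow> q k = q' k"
    have "R q n t = R q' n t" for t
      unfolding R_def
      by (intro arg_cong2[where f = "(-)"] arg_cong[where f = uminus] sum.cong refl)
        (auto simp: eq)
    then show "P q n r = P q' n r" by (simp add: P_def)
  next
    fix n and q :: "nat \<Rightarrow> (real \<Rightarrow> real) \<times> real"
    assume IH: "\<And>k. (k, n) \<in> {(x, y). x < y} \<Longrightarrow> P q k (q k)"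
    then have q: "fst (q k) \<in> cos_polys" if "k < n" for k using that by (auto simp: P_def)
    consider "n = 0" | "n = Suc 0" | "n \<ge> 2" by linarith
    then show "\<exists>r. P q n r"
    proof cases
      case 1
      then show ?thesis using assms cos_polys_zero by (intro exI[of _ "(\<lambda>_. 0, 0)"]) (simp add: P_def)
    next
      case 2
      then show ?thesis using assms cos_polys_cos by (intro exI[of _ "(cos, 0)"]) (simp add: P_def)
    next
      case 3
      have "(\<lambda>t. - 1 * (\<Sum>x \<in> cubic_index n.
            fst (q (fst x)) t * fst (q (fst (snd x))) t * fst (q (snd (snd x))) t)
          - (\<Sum>\<nu>=1..n - 2. snd (q (Suc \<nu>)) * deriv (deriv (fst (q (n - \<nu>)))) t)) \<in> cos_polys"
        by (intro cos_polys_diff cos_polys_cmult cos_polys_sum cos_polys_mult cos_polys_derivs q) auto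
      then have "R q n \<in> cos_polys" unfolding R_def by (simp add: case_prod_unfold)
      from forced_oscillator_detuned[OF this, of "v n"] obtain c g where
        "g \<in> cos_polys" "g 0 = v n" "\<forall>t. deriv (deriv g) t + g t = R q n t + c * cos t" by blast
      with 3 show ?thesis by (intro exI[of _ "(g, c)"]) (simp add: P_def)
    qed
  qed
  then obtain q where q: "\<And>n. P q n (q n)" by blast
  define g where "g n = fst (q n)" for n
  define \<theta> where "\<theta> \<nu> = (if \<nu> = 0 then 1 else snd (q (Suc \<nu>)))" for \<nu>
  have g01: "g 0 = (\<lambda>_. 0)" "g (Suc 0) = cos" and g: "g n \<in> cos_polys" "g n 0 = v n" for n
    using q[of 0] q[of "Suc 0"] q[of n] by (auto simp: P_def g_def)
  show thesis
  proof (rule that[of \<theta> g])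
    fix n :: nat and t :: real assume "n \<ge> 2"
    then obtain k where n: "n = Suc (Suc k)" by (metis add_2_eq_Suc le_Suc_ex)
    have "deriv (deriv (g n)) t + g n t = R q n t + \<theta> (Suc k) * cos t"
      using q[of n] \<open>n \<ge> 2\<close> by (simp add: P_def g_def \<theta>_def n)
    also have "R q n t = - (\<Sum>(\<mu>, \<nu>, \<rho>) \<in> cubic_index n. g \<mu> t * g \<nu> t * g \<rho> t)
       - (\<Sum>\<nu>=1..k. \<theta> \<nu> * deriv (deriv (g (n - \<nu>))) t)"
      unfolding R_def g_def[symmetric] by (simp add: n \<theta>_def)
    \<comment> \<open>Extending the sum to \<open>n\<close> adds
      \<open>- \<theta> (Suc k) * cos t\<close>, from the second derivative of the first-order term
      cos, and a term with \<open>g 0\<close>, which is 0.\<close>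
    also have "(\<Sum>\<nu>=1..k. \<theta> \<nu> * deriv (deriv (g (n - \<nu>))) t)
        = (\<Sum>\<nu>=1..n. \<theta> \<nu> * deriv (deriv (g (n - \<nu>))) t) + \<theta> (Suc k) * cos t"
      by (simp add: n g01 deriv_deriv_cos Suc_diff_le)
    finally show "deriv (deriv (g n)) t + g n t =
       - (\<Sum>(\<mu>, \<nu>, \<rho>) \<in> cubic_index n. g \<mu> t * g \<nu> t * g \<rho> t)
       - (\<Sum>\<nu>=1..n. \<theta> \<nu> * deriv (deriv (g (n - \<nu>))) t)" by simp
  qed (simp_all add: g g01 \<theta>_def)
qed

text \<open>Three ground modes do not excite any higher mode, since their interaction coefficient
  with \<open>m\<close> is the Kronecker delta. The Duffing expansion, extended by zero, therefore
  solves the full system.\<close>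

lemma ground_mode_solution:
  assumes "a 0 0 = 0" "a (Suc 0) 0 = 1" and higher: "\<And>n m. m \<ge> 1 \<Longrightarrow> a n m = 0"
  shows "\<exists>\<theta>. \<theta> 0 = 1 \<and> (\<exists>f. resonant_solution \<theta> a f \<and> no_secular_term f)"
proof -
  obtain g \<theta> where "\<theta> 0 = 1" and g: "\<And>n. g n \<in> cos_polys" "\<And>n. g n 0 = a n 0"
      "g 0 = (\<lambda>_. 0)" "g (Suc 0) = cos"
    and ode: "\<And>n t. n \<ge> 2 \<Longrightarrow> deriv (deriv (g n)) t + g n t =
       - (\<Sum>(\<mu>, \<nu>, \<rho>) \<in> cubic_index n. g \<mu> t * g \<nu> t * g \<rho> t)
       - (\<Sum>\<nu>=1..n. \<theta> \<nu> * deriv (deriv (g (n - \<nu>))) t)"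
  proof (rule duffing_expansion[of "\<lambda>n. a n 0", OF assms(1,2)])
    fix g \<theta>
    assume "\<theta> 0 = 1" "\<And>n. g n \<in> cos_polys" "\<And>n. g n 0 = a n 0" "g 0 = (\<lambda>_. 0)" "g (Suc 0) = cos"
      "\<And>n t. n \<ge> 2 \<Longrightarrow> deriv (deriv (g n)) t + g n t =
         - (\<Sum>(\<mu>, \<nu>, \<rho>) \<in> cubic_index n. g \<mu> t * g \<nu> t * g \<rho> t)
         - (\<Sum>\<nu>=1..n. \<theta> \<nu> * deriv (deriv (g (n - \<nu>))) t)"
    then show thesis by (rule that[of \<theta> g])
  qed
  define f where "f n m = (if m = 0 then g n else (\<lambda>_. 0))" for n m :: nat
  have f: "f n m \<in> cos_polys" for n m by (simp add: f_def g cos_polys_zero)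
  have cub: "cubic_term f n m t (i, j, k) = (if (i, j, k) = (0, 0, 0) \<and> m = 0
      then \<Sum>(\<mu>, \<nu>, \<rho>) \<in> cubic_index n. g \<mu> t * g \<nu> t * g \<rho> t else 0)" for n m t i j k
  proof (cases "i = 0 \<and> j = 0 \<and> k = 0")
    case True
    then show ?thesis by (simp add: cubic_term_def interaction_coeff_0_0 f_def)
  next
    case False
    then have "f \<mu> i t * f \<nu> j t * f \<rho> k t = 0" for \<mu> \<nu> \<rho> by (auto simp: f_def)
    then have "(\<Sum>(\<mu>, \<nu>, \<rho>) \<in> cubic_index n. f \<mu> i t * f \<nu> j t * f \<rho> k t) = 0"
      by (intro sum.neutral ballI) (simp only: split_paired_all case_prod_conv)
    then show ?thesis using False by (auto simp only: cubic_term_def case_prod_conv mult_zero_right prod.inject if_False simp_thms)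
  qed
  have off: "cubic_term f n m t x = 0" if "x \<notin> {(0, 0, 0)}" for n m t x
    using that by (cases x) (simp only: cub, auto)
  have summable: "cubic_term f n m t summable_on UNIV" for n m t
    by (rule infsum_finite_support(1)[where F = "{(0, 0, 0)}"]) (simp_all add: off)
  have inf: "infsum (cubic_term f n m t) UNIV = (if m = 0
      then \<Sum>(\<mu>, \<nu>, \<rho>) \<in> cubic_index n. g \<mu> t * g \<nu> t * g \<rho> t else 0)" for n m t
  proof -
    have "infsum (cubic_term f n m t) UNIV = sum (cubic_term f n m t) {(0, 0, 0)}"
      by (rule infsum_finite_support(2)) (simp_all add: off)
    then show ?thesis by (simp add: cub)
  qed
  have "resonant_solution \<theta> a f"
    unfolding resonant_solution_def
  proof (intro conjI allI impI)
    fix n m :: nat and t :: real assume n: "n \<ge> 2"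
    show "cubic_term f n m t summable_on UNIV"
      by (rule summable)
    show "deriv (deriv (f n m)) t + (eig_freq m)\<^sup>2 * f n m t = source \<theta> f n m t"
      unfolding source_eq inf using ode[OF n, of t] by (cases "m = 0") (simp_all add: f_def eig_freq_def)
  next
    show "deriv (f n m) 0 = 0" "f n m differentiable_on UNIV" "deriv (f n m) differentiable_on UNIV" for n m
      using cos_polys_derivs[OF f] by blast+
  qed (use higher in \<open>simp_all add: f_def g\<close>)
  moreover have "no_secular_term f"
    unfolding no_secular_term_def using cos_polys_periodic[OF f] by blast
  ultimately show ?thesis using \<open>\<theta> 0 = 1\<close> by (intro exI[of _ \<theta>] exI[of _ f] conjI)
qed

section \<open>The equivalences\<close>

theorem theorem1p1:
  fixes a :: "nat \<Rightarrow> nat \<Rightarrow> real"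
  assumes "\<And>m. a 0 m = 0"
    and "\<And>m. a 1 m = (if m = 0 then 1 else 0)"
  shows "((\<exists>\<theta>. \<theta> 0 = 1 \<and> (\<exists>f. resonant_solution \<theta> a f \<and> no_secular_term f))
            \<longleftrightarrow> (\<forall>n. \<forall>m\<ge>1. a n m = 0))
       \<and> ((\<forall>n. \<forall>m\<ge>1. a n m = 0)
            \<longleftrightarrow> (\<forall>n. has_eig_expansion (\<lambda>\<psi>. a n 0 * eig 0 \<psi>) (a n)))"
proof (intro conjI iffI)
  assume "\<exists>\<theta>. \<theta> 0 = 1 \<and> (\<exists>f. resonant_solution \<theta> a f \<and> no_secular_term f)"
  then obtain \<theta> f where sol: "resonant_solution \<theta> a f" and "no_secular_term f" by blast
  then have "f n m 0 = 0" if "m \<ge> 1" for n m using higher_modes_vanish[OF _ _ that] by simp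
  moreover have "f n m 0 = a n m" for n m using sol by (simp add: resonant_solution_def)
  ultimately show "\<forall>n. \<forall>m\<ge>1. a n m = 0" by simp
next
  assume "\<forall>n. \<forall>m\<ge>1. a n m = 0"
  then show "\<exists>\<theta>. \<theta> 0 = 1 \<and> (\<exists>f. resonant_solution \<theta> a f \<and> no_secular_term f)"
    using assms by (intro ground_mode_solution) auto
qed (simp_all add: has_eig_expansion_ground_iff)

end
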